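(* Let $f(X)=a_0+a_1X+\cdots+a_nX^n\in\mathbb{Z}[X]$ be a polynomial of degree $n\ge 2$ with $a_0\neq 0$, and denote by $j_1<j_2<\cdots<j_\ell$ all the indices $j\in\{0,\dots,n\}$ for which $a_j<0$. If $a_n>|a_{j_1}+\cdots+a_{j_\ell}|$ and $f(m)$ is a prime number for some integer $m>1+\frac{1}{\sin\frac{\pi}{n}}$, then $f$ is irreducible over $\mathbb{Q}$.
   Context: If $f$ has no negative coefficients ($\ell=0$), the sum $a_{j_1}+\cdots+a_{j_\ell}$ is the empty sum, equal to $0$. *)

theory Defs
  imports Complex_Main "HOL-Computational_Algebra.Computational_Algebra"
begin

end

(* For z with |z| > 1 / sin(pi/n) and |arg z| <= pi/n - pi/n^2, rotate f(z) / z^n by the angle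
   +-(pi/2 - pi/n).  The leading term then has real part a_n sin(pi/n), the terms with nonnegative
   coefficients land in the closed right half plane, and the negative ones contribute less than
   a_n sin(pi/n); hence f(z) is nonzero.  Concavity of the sine shows that the closed unit disc
   around m lies in this region, so a nonconstant integer factor g of f satisfies |g(m)| > 1 by
   writing g(m) as a product over the roots of g.  With Gauss's lemma this contradicts the
   primality of f(m). *)

theory Submission
  imports Defs "HOL-Analysis.Convex"
begin

section \<open>Sine estimates and the sector containing the unit disc around
  \<open>m\<close>\<close>

text \<open>Concavity: the chord from the origin to \<open>(x, sin x)\<close> lies below the graph.
  It serves twice below, for \<open>2 / n <= sin (pi / n)\<close> and for shrinking the angle
  \<open>pi / n\<close> by the factor \<open>1 - 1 / n\<close>.\<close>

lemma sin_scale_ge: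
  fixes t x :: real
  assumes "0 \<le> t" "t \<le> 1" "0 \<le> x" "x \<le> pi"
  shows "t * sin x \<le> sin (t * x)"
proof -
  have "concave_on {0..pi} (sin :: real \<Rightarrow> real)"
  proof (rule f''_le0_imp_concave)
    show "convex {0..pi}" by simp
    show "(sin has_real_derivative cos y) (at y)" for y :: real
      by (rule DERIV_sin)
    show "(cos has_real_derivative - sin y) (at y)" for y :: real
      by (rule DERIV_cos)
    show "- sin y \<le> 0" if "y \<in> {0..pi}" for y :: real
      using that sin_ge_zero by auto
  qed
  then have "convex_on {0..pi} (\<lambda>y::real. - sin y)"
    by (simp add: concave_on_def)
  from convex_onD[OF this, of t 0 x] assms show ?thesis
    by simp
qed

text \<open>Seen from 0, the unit disc around \<open>m\<close> spans a half-angle with sine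
  \<open>1 / m\<close>, so this says that it fits into the sector of half-angle
  \<open>pi / n - pi / n^2\<close>. With \<open>s = sin (pi / n)\<close>, concavity reduces the
  claim to \<open>1 / m <= (1 - 1 / n) * s\<close>. Since \<open>s * m > s + 1\<close>, it is enough
  that \<open>(1 - 1 / n) * (s + 1) >= 1\<close>, that is \<open>s * n >= s + 1\<close>, which
  follows from \<open>s * n >= 2\<close> and \<open>s <= 1\<close>.\<close>

lemma sector_bound:
  fixes n :: nat and m :: real
  assumes "n \<ge> 2" "m > 1 + 1 / sin (pi / n)"
  shows "1 / m \<le> sin (pi / n - pi / (real n)\<^sup>2)"
proof -
  define s where "s = sin (pi / n)"
  have n: "real n \<ge> 2" using assms(1) by simp
  have "2 / n * sin (pi / 2) \<le> sin (2 / n * (pi / 2))"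
    using n by (intro sin_scale_ge) auto
  then have s: "2 / n \<le> s" by (simp add: s_def)
  have "2 / n > 0" using n by simp
  then have s0: "s > 0" using s by linarith
  have m: "m > 1 + 1 / s" using assms(2) by (simp add: s_def)
  have m0: "m > 0" using m s0 by (smt (verit) divide_pos_pos)
  have "2 \<le> s * n" using s n by (simp add: field_simps)
  then have "s * n \<ge> s + 1"
    using sin_le_one[of "pi / n"] unfolding s_def by linarith
  then have "1 \<le> (1 - 1 / n) * (s + 1)" using n by (simp add: field_simps)
  also have "\<dots> = (1 - 1 / n) * (s * (1 + 1 / s))"
    using s0 by (simp add: field_simps)
  also have "\<dots> \<le> (1 - 1 / n) * (s * m)"
    using n s0 m by (intro mult_left_mono) auto
  finally have "1 / m \<le> (1 - 1 / n) * s"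
    using m0 by (simp add: field_simps)
  also have "\<dots> \<le> sin ((1 - 1 / n) * (pi / n))"
    unfolding s_def using n by (intro sin_scale_ge) (auto simp: field_simps)
  also have "(1 - 1 / n) * (pi / n) = pi / n - pi / (real n)\<^sup>2"
    by (simp add: left_diff_distrib diff_divide_distrib power2_eq_square)
  finally show ?thesis .
qed

lemma unit_disc_slope:
  fixes z :: complex and m :: real
  assumes "norm (z - of_real m) \<le> 1" "m > 1"
  shows "\<bar>Im z\<bar> \<le> norm z / m" "Re z > 0"
proof -
  have "\<bar>Re (z - of_real m)\<bar> \<le> 1"
    using abs_Re_le_cmod assms(1) order_trans by blast
  then show "Re z > 0" using assms(2) by simp
  have d: "(Re z - m)\<^sup>2 + (Im z)\<^sup>2 \<le> 1"
    using power_mono[OF assms(1), of 2] by (simp add: cmod_power2)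
  \<comment> \<open>With x = Re z and y = Im z, the difference x^2 + y^2 - (m y)^2 equals (m^2 - 1)
    (1 - (x - m)^2 - y^2) + (m x - (m^2 - 1))^2. The last square vanishes at the points where a line
    through 0 touches the unit circle around m.\<close>
  have "(m\<^sup>2 - 1) * ((Re z - m)\<^sup>2 + (Im z)\<^sup>2) \<le> (m\<^sup>2 - 1) * 1"
    using d assms(2) by (intro mult_left_mono) auto
  moreover have "(m * Re z - (m\<^sup>2 - 1))\<^sup>2 \<ge> 0" by simp
  ultimately have "(m * Im z)\<^sup>2 \<le> (Re z)\<^sup>2 + (Im z)\<^sup>2"
    by (simp add: power2_eq_square algebra_simps)
  then have "\<bar>m * Im z\<bar> \<le> norm z"
    unfolding cmod_def by (intro real_le_rsqrt) simp
  then show "\<bar>Im z\<bar> \<le> norm z / m"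
    using assms(2) by (simp add: abs_mult field_simps)
qed

text \<open>In the right half plane the argument lies in the range of \<open>arcsin\<close>, where
  the cosine is nonnegative. Bounds on \<open>Im z / norm z\<close> thereby become bounds on the
  angle.\<close>

lemma rcis_arcsin:
  assumes "Re z > 0"
  shows "z = rcis (norm z) (arcsin (Im z / norm z))"
proof -
  have z: "norm z > 0" using assms by auto
  have b: "\<bar>Im z / norm z\<bar> \<le> 1"
    using z abs_Im_le_cmod[of z] by simp
  have "1 - (Im z / norm z)\<^sup>2 = (Re z / norm z)\<^sup>2"
    using z unfolding power_divide cmod_power2[symmetric]
    by (simp add: diff_divide_eq_iff eq_divide_eq cmod_power2 complex_eq_iff)
  then have "cos (arcsin (Im z / norm z)) = Re z / norm z"
    using b assms z cos_arcsin[of "Im z / norm z"] by (simp only: abs_le_iff) simp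
  moreover have "sin (arcsin (Im z / norm z)) = Im z / norm z"
    using b by (intro sin_arcsin) linarith+
  ultimately show ?thesis
    using z by (intro complex_eqI) auto
qed

section \<open>Absence of roots near \<open>m\<close>\<close>

text \<open>After the rotation the real part is at least
  \<open>r ^ (n - 1) * (a_n * (r * s) - N)\<close>, where \<open>s = sin (pi / n)\<close> and
  \<open>N\<close> is the absolute value of the sum of the negative coefficients. This is positive
  because \<open>r * s > 1\<close> and \<open>a_n > N\<close>.\<close>

lemma poly_nonzero_in_sector:
  fixes f :: "int poly" and r \<phi> :: real
  defines "n \<equiv> degree f"
  assumes n: "n \<ge> 2"
    and lead: "coeff f n > \<bar>\<Sum>j\<in>{j\<in>{0..n}. coeff f j < 0}. coeff f j\<bar>"
    and r: "r > 1 / sin (pi / n)"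
    and phi: "\<bar>\<phi>\<bar> \<le> pi / n - pi / (real n)\<^sup>2"
  shows "poly (map_poly of_int f) (rcis r \<phi>) \<noteq> 0"
proof -
  define s where "s = sin (pi / n)"
  \<comment> \<open>The sign of \<open>\<beta>\<close> follows that of \<open>\<phi>\<close>, so up
    to sign the angle in \<open>c k\<close> is
    \<open>pi / 2 - pi / n - k * \<bar>\<phi>\<bar>\<close>. It starts at
    \<open>pi / 2 - pi / n\<close>, whose cosine is \<open>s\<close>. As
    \<open>n * \<bar>\<phi>\<bar> <= pi - pi / n\<close>, it is still at least
    \<open>- pi / 2\<close> for \<open>k = n\<close>, so no cosine up to there is negative.\<close>
  define \<beta> where "\<beta> = (if \<phi> \<ge> 0 then 1 else - 1) * (pi / 2 - pi / n)"
  define c where "c k = cos (\<beta> - real k * \<phi>)" for k :: nat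
  define N where "N = - (\<Sum>j\<in>{j\<in>{0..n}. coeff f j < 0}. real_of_int (coeff f j))"
  have n2: "real n \<ge> 2" using n by simp
  have s0: "s > 0" unfolding s_def using n2 by (intro sin_gt_zero) (auto simp: field_simps)
  have rs: "r * s > 1" using r s0 by (simp add: s_def[symmetric] field_simps)
  have "1 \<le> 1 / s" using s0 by (simp add: s_def)
  then have r1: "r > 1" using r by (simp add: s_def)
  have c_abs: "c k = cos (pi / 2 - pi / n - real k * \<bar>\<phi>\<bar>)" for k
    unfolding c_def \<beta>_def using cos_minus[of "pi / 2 - pi / n - real k * \<bar>\<phi>\<bar>"] by (cases "\<phi> \<ge> 0") (simp_all add: algebra_simps)
  have c0: "c 0 = s"
    unfolding c_abs s_def by (simp add: cos_diff)
  have c_nonneg: "c k \<ge> 0" if "k \<le> n" for k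
  proof -
    have "real k * \<bar>\<phi>\<bar> \<le> n * (pi / n - pi / (real n)\<^sup>2)"
      using that phi by (intro mult_mono) auto
    also have "\<dots> = pi - pi / n"
      using n2 by (simp add: field_simps power2_eq_square)
    finally have "real k * \<bar>\<phi>\<bar> \<le> pi - pi / n" .
    moreover have "0 \<le> real k * \<bar>\<phi>\<bar>" by simp
    moreover have "0 < pi / n" using n2 by simp
    ultimately show ?thesis
      unfolding c_abs by (intro cos_ge_zero) linarith+
  qed
  have c_le: "c k \<le> 1" for k
    by (simp add: c_def)
  have real_lead: "real_of_int (coeff f n) > \<bar>N\<bar>"
    using lead unfolding N_def by (simp flip: of_int_sum of_int_abs)
  \<comment> \<open>In this form \<open>N\<close> can be compared termwise with the non-leading part
    of the polynomial; the index \<open>n\<close> drops out because the leading coefficient is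
    positive.\<close>
  have N: "N = - (\<Sum>k<n. min (real_of_int (coeff f k)) 0)"
  proof -
    have "(\<Sum>j\<in>{j\<in>{0..n}. coeff f j < 0}. real_of_int (coeff f j))
      = (\<Sum>k<n. min (real_of_int (coeff f k)) 0)"
    proof (rule sum.mono_neutral_cong_left)
      show "{j \<in> {0..n}. coeff f j < 0} \<subseteq> {..<n}"
      proof
        fix k assume k: "k \<in> {j \<in> {0..n}. coeff f j < 0}"
        then have "k \<noteq> n" using lead by force
        with k show "k \<in> {..<n}" by simp
      qed
    qed (auto simp: min_def)
    then show ?thesis by (simp add: N_def)
  qed
  have deg: "degree (map_poly (of_int :: int \<Rightarrow> complex) f) = n"
    unfolding n_def by (rule degree_map_poly) simp
  \<comment> \<open>Multiplying by \<open>cis (\<beta> - n * \<phi>)\<close> removes the direction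
    of \<open>z^n\<close> and then rotates by \<open>\<beta>\<close>, so the term of index
    \<open>k\<close> acquires the cosine \<open>c (n - k)\<close>.\<close>
  have "Re (cis (\<beta> - n * \<phi>) * poly (map_poly of_int f) (rcis r \<phi>))
      = (\<Sum>k\<le>n. real_of_int (coeff f k) * r ^ k * c (n - k))"
    unfolding poly_altdef deg sum_distrib_left Re_sum
  proof (rule sum.cong)
    fix k assume "k \<in> {..n}"
    then have e: "real (n - k) = real n - real k" by auto
    have "cis (\<beta> - n * \<phi>) * (coeff (map_poly of_int f) k * rcis r \<phi> ^ k)
        = of_real (real_of_int (coeff f k) * r ^ k) * (cis (\<beta> - n * \<phi>) * cis (k * \<phi>))"
      by (simp add: coeff_map_poly rcis_def power_mult_distrib DeMoivre)
    also have "cis (\<beta> - n * \<phi>) * cis (k * \<phi>) = cis (\<beta> - real (n - k) * \<phi>)"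
      unfolding cis_mult e by (simp add: algebra_simps)
    finally show "Re (cis (\<beta> - n * \<phi>) * (coeff (map_poly of_int f) k * rcis r \<phi> ^ k))
        = real_of_int (coeff f k) * r ^ k * c (n - k)"
      unfolding c_def by simp
  qed simp
  also have "\<dots> = real_of_int (coeff f n) * r ^ n * s
      + (\<Sum>k<n. real_of_int (coeff f k) * r ^ k * c (n - k))"
    by (simp add: lessThan_Suc_atMost[symmetric] c0)
  \<comment> \<open>Terms with nonnegative coefficients are bounded below by 0. In the others
    \<open>r ^ k * c (n - k) <= r ^ (n - 1)\<close>, because \<open>k <= n - 1\<close>,
    \<open>r > 1\<close> and the cosine is at most 1.\<close>
  also have "\<dots> \<ge> real_of_int (coeff f n) * r ^ n * s
      + (\<Sum>k<n. min (real_of_int (coeff f k)) 0 * r ^ (n - 1))"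
  proof (intro add_left_mono sum_mono)
    fix k assume k: "k \<in> {..<n}"
    show "min (real_of_int (coeff f k)) 0 * r ^ (n - 1)
        \<le> real_of_int (coeff f k) * r ^ k * c (n - k)"
    proof (cases "coeff f k \<ge> 0")
      case True
      then show ?thesis using c_nonneg[of "n - k"] r1 by (simp add: min_def)
    next
      case False
      have "r ^ k * c (n - k) \<le> r ^ (n - 1) * 1"
        using k r1 c_nonneg c_le by (intro mult_mono power_increasing) auto
      then show ?thesis using False
        by (simp add: min_def mult.assoc mult_left_mono_neg)
    qed
  qed
  also have "real_of_int (coeff f n) * r ^ n * s
      + (\<Sum>k<n. min (real_of_int (coeff f k)) 0 * r ^ (n - 1))
      = r ^ (n - 1) * (real_of_int (coeff f n) * (r * s) - N)"
  proof -
    have "r ^ n = r ^ (n - 1) * r" using n by (cases n) auto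
    then show ?thesis
      unfolding N by (simp add: sum_distrib_right[symmetric] algebra_simps)
  qed
  finally have ge: "Re (cis (\<beta> - n * \<phi>) * poly (map_poly of_int f) (rcis r \<phi>))
      \<ge> r ^ (n - 1) * (real_of_int (coeff f n) * (r * s) - N)" by simp
  have "real_of_int (coeff f n) * (r * s) \<ge> real_of_int (coeff f n) * 1"
    using rs real_lead by (intro mult_left_mono) auto
  then have "r ^ (n - 1) * (real_of_int (coeff f n) * (r * s) - N) > 0"
    using real_lead r1 by (intro mult_pos_pos) auto
  with ge show ?thesis by auto
qed

text \<open>A root in the closed disc would have modulus at least
  \<open>m - 1 > 1 / sin (pi / n)\<close> and an angle whose sine is at most \<open>1 / m\<close> in
  absolute value, hence would lie in the root-free sector.\<close>

lemma roots_outside_unit_disc: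
  fixes f :: "int poly" and m :: real
  assumes n: "degree f \<ge> 2"
    and lead: "coeff f (degree f) > \<bar>\<Sum>j\<in>{j\<in>{0..degree f}. coeff f j < 0}. coeff f j\<bar>"
    and m: "m > 1 + 1 / sin (pi / degree f)"
    and root: "poly (map_poly of_int f) (z :: complex) = 0"
  shows "norm (of_real m - z) > 1"
proof (rule ccontr)
  let ?n = "degree f"
  let ?\<phi> = "arcsin (Im z / norm z)" and ?\<alpha> = "pi / ?n - pi / (real ?n)\<^sup>2"
  assume "\<not> ?thesis"
  then have d: "norm (z - of_real m) \<le> 1" by (simp add: norm_minus_commute)
  have n2: "real ?n \<ge> 2" using n by simp
  have "sin (pi / ?n) > 0" using n2 by (intro sin_gt_zero) (auto simp: field_simps)
  then have m1: "m > 1" using m by (smt (verit) divide_pos_pos)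
  note slope = unit_disc_slope[OF d m1]
  have z: "norm z > 0" using slope(2) by auto
  have "m \<le> norm z + norm (z - of_real m)"
    using norm_triangle_ineq4[of z "z - of_real m"] m1 by simp
  then have r: "norm z > 1 / sin (pi / ?n)" using m d by linarith
  have "\<bar>Im z / norm z\<bar> \<le> 1 / m"
    using slope(1) z m1 by (simp add: field_simps)
  also have "\<dots> \<le> sin ?\<alpha>"
    using sector_bound[OF n m] by simp
  finally have b: "\<bar>Im z / norm z\<bar> \<le> sin ?\<alpha>" .
  have \<alpha>: "0 \<le> ?\<alpha>" "?\<alpha> \<le> pi / 2"
  proof -
    have "pi / (real ?n)\<^sup>2 \<le> pi / ?n"
      using n2 by (intro divide_left_mono) (auto simp: power2_eq_square)
    then show "0 \<le> ?\<alpha>" by simp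
    have "pi / ?n \<le> pi / 2" using n2 by (intro divide_left_mono) auto
    moreover have "0 \<le> pi / (real ?n)\<^sup>2" by simp
    ultimately show "?\<alpha> \<le> pi / 2" by linarith
  qed
  have b1: "\<bar>Im z / norm z\<bar> \<le> 1" using z abs_Im_le_cmod[of z] by simp
  have "?\<phi> \<le> arcsin (sin ?\<alpha>)"
    using b b1 sin_le_one[of ?\<alpha>] by (intro arcsin_le_arcsin) linarith+
  moreover have "arcsin (- sin ?\<alpha>) \<le> ?\<phi>"
    using b b1 sin_le_one[of ?\<alpha>] by (intro arcsin_le_arcsin) linarith+
  moreover have "arcsin (sin ?\<alpha>) = ?\<alpha>"
    using \<alpha> by (intro arcsin_sin) linarith+
  moreover have "arcsin (- sin ?\<alpha>) = - ?\<alpha>"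
    using \<alpha> arcsin_sin[of "- ?\<alpha>"] unfolding sin_minus by linarith
  ultimately have "\<bar>?\<phi>\<bar> \<le> ?\<alpha>" by linarith
  from poly_nonzero_in_sector[OF n lead r this] root rcis_arcsin[OF slope(2)]
  show False by simp
qed

section \<open>Values of integer factors at \<open>m\<close>\<close>

lemma prod_mset_gt_1:
  fixes h :: "'a \<Rightarrow> 'b :: linordered_idom"
  assumes "A \<noteq> {#}" "\<And>x. x \<in># A \<Longrightarrow> h x > 1"
  shows "(\<Prod>x\<in>#A. h x) > 1"
  using assms
proof (induction A)
  case (add x A)
  show ?case
  proof (cases "A = {#}")
    case False
    then show ?thesis using add by (simp add: less_1_mult)
  qed (use add in simp)
qed simp

text \<open>Over the complex numbers, \<open>norm (poly p w)\<close> is the modulus of the leading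
  coefficient times the product of the distances from \<open>w\<close> to the roots; positive degree
  makes this product nonempty, hence strictly greater than 1.\<close>

lemma norm_poly_gt_1:
  fixes p :: "complex poly"
  assumes "degree p > 0" "norm (lead_coeff p) \<ge> 1"
    and roots: "\<And>x. poly p x = 0 \<Longrightarrow> norm (w - x) > 1"
  shows "norm (poly p w) > 1"
proof -
  have "p \<noteq> 0" using assms(1) by auto
  then obtain A where A: "size A = degree p"
      and p: "p = smult (lead_coeff p) (\<Prod>x\<in>#A. [:-x, 1:])"
    using alg_closed_imp_factorization by blast
  have "poly p x = 0" if "x \<in># A" for x
  proof (subst p)
    show "poly (smult (lead_coeff p) (\<Prod>x\<in>#A. [:-x, 1:])) x = 0"
      using that by (auto simp: poly_prod_mset prod_mset_zero_iff intro!: image_eqI[of _ _ x])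
  qed
  then have gt: "(\<Prod>x\<in>#A. norm (w - x)) > 1"
    using A assms(1) roots by (intro prod_mset_gt_1) auto
  have "norm (\<Prod>x\<in>#B. w - x) = (\<Prod>x\<in>#B. norm (w - x))" for B
    by (induction B) (simp_all add: norm_mult)
  then have eq: "norm (poly p w) = norm (lead_coeff p) * (\<Prod>x\<in>#A. norm (w - x))"
    by (subst p) (simp add: poly_prod_mset norm_mult)
  have "1 * (\<Prod>x\<in>#A. norm (w - x)) \<le> norm (lead_coeff p) * (\<Prod>x\<in>#A. norm (w - x))"
    using gt assms(2) by (intro mult_right_mono) auto
  then show ?thesis unfolding eq using gt by linarith
qed

lemma map_poly_of_int_mult:
  "map_poly of_int (p * q) = (map_poly of_int p * map_poly of_int q :: 'a :: comm_ring_1 poly)"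
  by (intro poly_eqI) (simp add: coeff_map_poly coeff_mult)

lemma map_poly_of_int_smult:
  "map_poly of_int (smult c p) = (smult (of_int c) (map_poly of_int p) :: 'a :: comm_ring_1 poly)"
  by (intro poly_eqI) (simp add: coeff_map_poly)

lemma map_poly_of_int_inject:
  "map_poly of_int p = (map_poly of_int q :: 'a :: ring_char_0 poly) \<longleftrightarrow> p = q"
  by (simp add: poly_eq_iff coeff_map_poly)

lemma degree_map_poly_of_int:
  "degree (map_poly of_int p :: 'a :: ring_char_0 poly) = degree p"
  by (rule degree_map_poly) simp

lemma poly_map_poly_of_int:
  "poly (map_poly of_int p) (of_int x) = (of_int (poly p x) :: 'a :: comm_ring_1)"
  by (induction p) (simp_all add: map_poly_pCons)

text \<open>The roots of \<open>g\<close> are among those of \<open>f\<close>, and a nonzero integer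
  leading coefficient has absolute value at least 1.\<close>

lemma abs_poly_factor_gt_1:
  fixes f g :: "int poly" and m :: int
  assumes "g dvd f" "degree g > 0"
    and roots: "\<And>z::complex. poly (map_poly of_int f) z = 0 \<Longrightarrow> norm (of_int m - z) > 1"
  shows "\<bar>poly g m\<bar> > 1"
proof -
  let ?g = "map_poly of_int g :: complex poly"
  obtain h where f: "f = g * h" using assms(1) by auto
  have "norm (poly ?g (of_int m)) > 1"
  proof (rule norm_poly_gt_1)
    show "degree ?g > 0" using assms(2) by (simp add: degree_map_poly_of_int)
    have "lead_coeff g \<noteq> 0" using assms(2) by auto
    then have "1 \<le> \<bar>lead_coeff g\<bar>" by linarith
    then have "1 \<le> real_of_int \<bar>lead_coeff g\<bar>" by linarith
    then show "norm (lead_coeff ?g) \<ge> 1"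
      by (simp add: degree_map_poly_of_int coeff_map_poly)
    show "norm (of_int m - x) > 1" if "poly ?g x = 0" for x
      using that by (intro roots) (simp add: f map_poly_of_int_mult)
  qed
  then show ?thesis by (simp add: poly_map_poly_of_int)
qed

section \<open>Gauss's lemma\<close>

lemma clear_denominators:
  fixes p :: "rat poly"
  shows "\<exists>d q. d \<noteq> 0 \<and> smult (rat_of_int d) p = map_poly of_int q"
proof (induction p)
  case 0
  have "smult (rat_of_int 1) 0 = map_poly of_int 0" by simp
  then show ?case by (metis zero_neq_one)
next
  case (pCons a p)
  then obtain d q where d: "d \<noteq> 0" "smult (rat_of_int d) p = map_poly of_int q" by blast
  obtain u v where a: "a = rat_of_int u / rat_of_int v" "v \<noteq> 0"
    by (metis quotient_of_div quotient_of_denom_pos order_less_irrefl surj_pair)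
  have "smult (rat_of_int (d * v)) (pCons a p) = pCons (of_int (d * u)) (smult (of_int v) (smult (of_int d) p))"
    using a by (simp add: mult.commute)
  also have "\<dots> = map_poly of_int (pCons (d * u) (smult v q))"
    unfolding d by (simp add: map_poly_pCons map_poly_of_int_smult)
  finally have "smult (rat_of_int (d * v)) (pCons a p) = map_poly of_int (pCons (d * u) (smult v q))" .
  moreover have "d * v \<noteq> 0" using d a by simp
  ultimately show ?case by blast
qed

lemma int_factorization_of_rat_factorization:
  fixes f :: "int poly" and a b :: "rat poly"
  assumes "map_poly rat_of_int f = a * b"
  obtains g h where "f = g * h" "degree g = degree a" "degree h = degree b"
proof -
  obtain d p where p: "d \<noteq> 0" "smult (rat_of_int d) a = map_poly of_int p"
    using clear_denominators by blast
  obtain e q where q: "e \<noteq> 0" "smult (rat_of_int e) b = map_poly of_int q"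
    using clear_denominators by blast
  have "map_poly rat_of_int (smult (d * e) f) = map_poly of_int (p * q)"
    by (simp add: map_poly_of_int_smult map_poly_of_int_mult assms flip: p q)
       (simp add: mult.commute)
  then have eq: "smult (d * e) f = p * q" by (simp only: map_poly_of_int_inject)
  \<comment> \<open>Primitive parts are multiplicative, and of the cleared denominator
    \<open>d * e\<close> they retain only the sign. Restoring the content of \<open>f\<close> then
    gives an integer factorization with the original degrees.\<close>
  have "smult (sgn (d * e)) (primitive_part f) = primitive_part p * primitive_part q"
    using arg_cong[OF eq, of primitive_part] by (simp add: primitive_part_mult primitive_part_smult)
  then have "smult (sgn (d * e) * sgn (d * e)) (primitive_part f)
      = smult (sgn (d * e)) (primitive_part p * primitive_part q)"
    by (metis smult_smult)
  moreover have "sgn (d * e) * sgn (d * e) = 1"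
    using p(1) q(1) by (simp add: sgn_if)
  ultimately have "primitive_part f = smult (sgn (d * e)) (primitive_part p * primitive_part q)"
    by simp
  then have "f = smult (content f * sgn (d * e)) (primitive_part p * primitive_part q)"
    by (metis content_times_primitive_part smult_smult)
  then have f: "f = smult (content f * sgn (d * e)) (primitive_part p) * primitive_part q"
    by simp
  have dp: "degree p = degree a"
    using arg_cong[OF p(2), of degree] p(1) by (simp add: degree_map_poly_of_int)
  have dq: "degree q = degree b"
    using arg_cong[OF q(2), of degree] q(1) by (simp add: degree_map_poly_of_int)
  show thesis
  \<comment> \<open>For \<open>f = 0\<close> the scalar \<open>content f * sgn (d * e)\<close> is 0
    and would destroy the degree of the first factor, so the pair is chosen directly.\<close>
  proof (cases "f = 0")
    case True
    then have "a = 0 \<or> b = 0" using assms by simp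
    then show thesis
    proof
      assume "a = 0"
      then show thesis using that[of 0 q] True dq by simp
    next
      assume "b = 0"
      then show thesis using that[of p 0] True dp by simp
    qed
  next
    case False
    then have "content f * sgn (d * e) \<noteq> 0" using p(1) q(1) by (simp add: sgn_if)
    with that[OF f] dp dq show thesis by simp
  qed
qed

section \<open>Irreducibility over the rationals\<close>

theorem corollary3p6:
  fixes f :: "int poly" and n :: nat and m :: int
  assumes "degree f = n" and "n \<ge> 2"
    and "coeff f 0 \<noteq> 0"
    and "coeff f n > \<bar>\<Sum>j\<in>{j\<in>{0..n}. coeff f j < 0}. coeff f j\<bar>"
    and "real_of_int m > 1 + 1 / sin (pi / real n)"
    and "prime (poly f m)"
  shows "irreducible (map_poly rat_of_int f)"
proof (rule irreducibleI)
  let ?F = "map_poly rat_of_int f"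
  have dF: "degree ?F = n" using assms(1) by (simp add: degree_map_poly_of_int)
  then show "?F \<noteq> 0" using assms(2) by auto
  show "\<not> ?F dvd 1" using dF assms(2) \<open>?F \<noteq> 0\<close> by (simp add: is_unit_iff_degree)
  fix a b assume ab: "?F = a * b"
  then have nz: "a \<noteq> 0" "b \<noteq> 0" using \<open>?F \<noteq> 0\<close> by auto
  obtain g h where gh: "f = g * h" "degree g = degree a" "degree h = degree b"
    using int_factorization_of_rat_factorization[OF ab] .
  have roots: "norm (of_int m - z) > 1" if "poly (map_poly of_int f) z = 0" for z :: complex
    using roots_outside_unit_disc[of f "real_of_int m" z] assms that by simp
  have "prime (poly g m * poly h m)" using assms(6) gh(1) by simp
  \<comment> \<open>One of the two factors takes the value 1 or -1 at \<open>m\<close>. The bound on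
    factor values forces it to be constant, so the matching rational factor is a nonzero constant
    and thus a unit.\<close>
  then have "is_unit (poly g m) \<or> is_unit (poly h m)"
    using prime_elem_imp_irreducible irreducibleD by blast
  then have "\<bar>poly g m\<bar> = 1 \<or> \<bar>poly h m\<bar> = 1" by simp
  then have "degree g = 0 \<or> degree h = 0"
    using abs_poly_factor_gt_1[of g f m] abs_poly_factor_gt_1[of h f m] roots gh(1) by force
  then show "a dvd 1 \<or> b dvd 1"
    using gh nz by (auto simp: is_unit_iff_degree)
qed

end
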